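(* Let $Q_i\in\mathbf{R}^{n\times n}$, $i\in\mathbf{I}[1,N]$, be $N$ given positive definite matrices and let $\tau_i>0$, $i\in\mathbf{I}[1,N]$, be $N$ given scalars. Assume that the vector functions $\omega_i:[-\tau_i,0]\to\mathbf{R}^n$, $i\in\mathbf{I}[1,N]$, are such that the integrals in the following are well-defined. Then $$\Big(\sum_{i=1}^{N}x_i\Big)^{\mathrm{T}}Q^{-1}\Big(\sum_{i=1}^{N}x_i\Big)\le\sum_{i=1}^{N}\int_{-\tau_i}^{0}\omega_i^{\mathrm{T}}(s)\,\tau_iQ_i^{-1}\,\omega_i(s)\,\mathrm{d}s,$$ where $x_i=\int_{-\tau_i}^{0}\omega_i(s)\,\mathrm{d}s$, $i\in\mathbf{I}[1,N]$, and $Q=\sum_{i=1}^{N}Q_i$. Moreover, for any vectors $\xi_i\in\mathbf{R}^n$, $i\in\mathbf{I}[1,N]$, $$\Big(\sum_{i=1}^{N}\xi_i\Big)^{\mathrm{T}}\Big(\sum_{i=1}^{N}Q_i\Big)^{-1}\Big(\sum_{i=1}^{N}\xi_i\Big)\le\sum_{i=1}^{N}\xi_i^{\mathrm{T}}Q_i^{-1}\xi_i .$$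
   Context: Notation: $\mathbf{I}[1,N]=\{1,2,\ldots,N\}$. Positive definite matrices are real symmetric. *)

theory Defs imports "HOL-Analysis.Analysis" begin

definition positive_definite :: "real ^ 'n ^ 'n \<Rightarrow> bool" where
  "positive_definite A \<longleftrightarrow>
     transpose A = A \<and> (\<forall>x. x \<noteq> 0 \<longrightarrow> x \<bullet> (A *v x) > 0)"

end

theory Submission imports Defs begin

text \<open>
  For a positive definite \<open>A\<close> the quadratic form of the inverse is, up to scaling, the
  Fenchel conjugate of the form of \<open>A\<close>:
  \<open>x \<bullet> A\<^sup>-\<^sup>1 x = max\<^sub>v (2 (v \<bullet> x) - v \<bullet> A v)\<close>,
  with the maximum at \<open>v = A\<^sup>-\<^sup>1 x\<close>. Both inequalities follow from bounding every
  \<open>2 (v \<bullet> x) - v \<bullet> A v\<close> by the maximum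
  (lemma \<open>positive_definite_Fenchel_Young\<close>) at one well-chosen \<open>v\<close>.

  For the sum of matrices, take the same \<open>v = (\<Sum> Q\<^sub>i)\<^sup>-\<^sup>1 (\<Sum> \<xi>\<^sub>i)\<close> for
  every \<open>i\<close>: the expression under the maximum is linear in the pair \<open>(x, A)\<close>, so its
  values at the pairs \<open>(\<xi>\<^sub>i, Q\<^sub>i)\<close> sum to the value at
  \<open>(\<Sum> \<xi>\<^sub>i, \<Sum> Q\<^sub>i)\<close>, for which this \<open>v\<close> is the maximizer. This is the joint
  convexity of \<open>(x, A) \<mapsto> x \<bullet> A\<^sup>-\<^sup>1 x\<close>. For a single integral, a constant
  \<open>v\<close> gives an affine lower bound of the integrand, the supporting hyperplane in the proof of
  Jensen's inequality, which is then integrated. The first inequality of the theorem combines the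
  two: the sum inequality at the integrals \<open>x\<^sub>i\<close>, and Jensen's inequality for each \<open>i\<close>.
\<close>

lemma positive_definite_inner_commute:
  assumes "positive_definite A"
  shows "v \<bullet> (A *v w) = w \<bullet> (A *v v)"
  using assms unfolding positive_definite_def
  by (metis dot_lmul_matrix inner_commute transpose_matrix_vector)

lemma positive_definite_nonneg:
  assumes "positive_definite A"
  shows "v \<bullet> (A *v v) \<ge> 0"
  using assms by (cases "v = 0") (auto simp: positive_definite_def less_imp_le)

lemma positive_definite_invertible:
  assumes "positive_definite A"
  shows "invertible A"
proof -
  have "x = 0" if "A *v x = 0" for x
    using assms that unfolding positive_definite_def by (metis inner_zero_right less_irrefl)
  then show ?thesis
    by (simp add: invertible_left_inverse matrix_left_invertible_ker)
qed

lemma positive_definite_mult_inv: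
  assumes "positive_definite A"
  shows "A *v (matrix_inv A *v x) = x"
proof -
  have "A ** matrix_inv A = mat 1"
    using someI_ex[OF positive_definite_invertible[OF assms, unfolded invertible_def]]
    by (simp add: matrix_inv_def)
  then show ?thesis
    by (simp add: matrix_vector_mul_assoc)
qed

lemma sum_matrix_vector_mult:
  fixes A :: "'i \<Rightarrow> real ^ 'n ^ 'm"
  shows "(\<Sum>i\<in>I. A i) *v v = (\<Sum>i\<in>I. A i *v v)"
  by (induction I rule: infinite_finite_induct) (simp_all add: matrix_vector_mult_add_rdistrib)

lemma positive_definite_sum:
  assumes "finite I" "I \<noteq> {}" and "\<And>i. i \<in> I \<Longrightarrow> positive_definite (A i)"
  shows "positive_definite (\<Sum>i\<in>I. A i)"
proof -
  have "transpose (\<Sum>i\<in>I. A i) = (\<Sum>i\<in>I. transpose (A i))"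
    by (simp add: transpose_def vec_eq_iff)
  also have "\<dots> = (\<Sum>i\<in>I. A i)"
    using assms(3) by (intro sum.cong) (auto simp: positive_definite_def)
  finally have "transpose (\<Sum>i\<in>I. A i) = (\<Sum>i\<in>I. A i)" .
  moreover have "x \<bullet> ((\<Sum>i\<in>I. A i) *v x) > 0" if "x \<noteq> 0" for x
    using assms that unfolding sum_matrix_vector_mult inner_sum_right
    by (intro sum_pos) (auto simp: positive_definite_def)
  ultimately show ?thesis
    by (simp add: positive_definite_def)
qed

text \<open>Expanding the nonnegative form \<open>(v - w) \<bullet> A (v - w)\<close> at the maximizer
  \<open>w = A\<^sup>-\<^sup>1 x\<close> gives exactly the difference of the two sides.\<close>

lemma positive_definite_Fenchel_Young:
  assumes "positive_definite A"
  shows "2 * (v \<bullet> x) \<le> v \<bullet> (A *v v) + x \<bullet> (matrix_inv A *v x)"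
proof -
  define w where "w = matrix_inv A *v x"
  have Aw: "A *v w = x"
    unfolding w_def using assms by (rule positive_definite_mult_inv)
  have "0 \<le> (v - w) \<bullet> (A *v (v - w))"
    using assms by (rule positive_definite_nonneg)
  also have "\<dots> = v \<bullet> (A *v v) - v \<bullet> x - w \<bullet> (A *v v) + w \<bullet> x"
    by (simp add: matrix_vector_mult_diff_distrib inner_diff_left inner_diff_right Aw)
  also have "w \<bullet> (A *v v) = v \<bullet> x"
    using positive_definite_inner_commute[OF assms, of w v] by (simp add: Aw)
  finally show ?thesis
    by (simp add: w_def[symmetric] inner_commute)
qed

lemma sum_inner_matrix_inv_le:
  assumes "finite I" "I \<noteq> {}" and pd: "\<And>i. i \<in> I \<Longrightarrow> positive_definite (A i)"
  shows "(\<Sum>i\<in>I. \<xi> i) \<bullet> (matrix_inv (\<Sum>i\<in>I. A i) *v (\<Sum>i\<in>I. \<xi> i))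
           \<le> (\<Sum>i\<in>I. \<xi> i \<bullet> (matrix_inv (A i) *v \<xi> i))"
proof -
  define v where "v = matrix_inv (\<Sum>i\<in>I. A i) *v (\<Sum>i\<in>I. \<xi> i)"
  have "(\<Sum>i\<in>I. A i) *v v = (\<Sum>i\<in>I. \<xi> i)"
    unfolding v_def using assms by (intro positive_definite_mult_inv positive_definite_sum)
  then have Av: "v \<bullet> (\<Sum>i\<in>I. A i *v v) = v \<bullet> (\<Sum>i\<in>I. \<xi> i)"
    by (simp add: sum_matrix_vector_mult)
  have "(\<Sum>i\<in>I. 2 * (v \<bullet> \<xi> i))
      \<le> (\<Sum>i\<in>I. v \<bullet> (A i *v v) + \<xi> i \<bullet> (matrix_inv (A i) *v \<xi> i))"
    by (intro sum_mono positive_definite_Fenchel_Young pd)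
  then have "2 * (v \<bullet> (\<Sum>i\<in>I. \<xi> i))
      \<le> v \<bullet> (\<Sum>i\<in>I. \<xi> i) + (\<Sum>i\<in>I. \<xi> i \<bullet> (matrix_inv (A i) *v \<xi> i))"
    by (simp only: sum.distrib Av flip: sum_distrib_left inner_sum_right)
  then show ?thesis
    by (simp add: v_def[symmetric] inner_commute)
qed

text \<open>Jensen's inequality for the convex form \<open>y \<mapsto> y \<bullet> A\<^sup>-\<^sup>1 y\<close>, scaled by
  \<open>(b - a)\<^sup>2\<close>.\<close>

lemma integral_inner_matrix_inv_le:
  fixes f :: "real \<Rightarrow> real ^ 'n"
  assumes pd: "positive_definite A" and "a < b"
    and f: "f integrable_on {a..b}"
    and q: "(\<lambda>s. f s \<bullet> (((b - a) *\<^sub>R matrix_inv A) *v f s)) integrable_on {a..b}"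
  shows "integral {a..b} f \<bullet> (matrix_inv A *v integral {a..b} f)
           \<le> integral {a..b} (\<lambda>s. f s \<bullet> (((b - a) *\<^sub>R matrix_inv A) *v f s))"
proof -
  define x where "x = integral {a..b} f"
  define w where "w = matrix_inv A *v x"
  define c where "c = b - a"
  have "c > 0" using \<open>a < b\<close> by (simp add: c_def)
  have Aw: "A *v w = x"
    unfolding w_def using pd by (rule positive_definite_mult_inv)
  \<comment> \<open>The rescaling to \<open>c *\<^sub>R f s\<close> makes the right-hand side integrate to
    \<open>x \<bullet> w\<close> plus the integral of the form; equality holds where \<open>f s\<close> is the mean
    \<open>x / c\<close>.\<close>
  have pointwise: "2 * (w \<bullet> f s) \<le> (x \<bullet> w) / c + f s \<bullet> ((c *\<^sub>R matrix_inv A) *v f s)" for s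
  proof -
    have "2 * (w \<bullet> (c *\<^sub>R f s))
        \<le> w \<bullet> (A *v w) + (c *\<^sub>R f s) \<bullet> (matrix_inv A *v (c *\<^sub>R f s))"
      using pd by (rule positive_definite_Fenchel_Young)
    then have "c * (2 * (w \<bullet> f s))
        \<le> c * ((x \<bullet> w) / c + f s \<bullet> ((c *\<^sub>R matrix_inv A) *v f s))"
      using \<open>c > 0\<close>
      by (simp add: Aw inner_commute[of x w] matrix_vector_mult_scaleR distrib_left mult.left_commute
          flip: scaleR_matrix_vector_assoc)
    then show ?thesis using \<open>c > 0\<close> by simp
  qed
  have "((\<lambda>s. 2 * (w \<bullet> f s)) has_integral 2 * (w \<bullet> x)) {a..b}"
    using has_integral_linear[OF integrable_integral[OF f] bounded_linear_inner_right, of w]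
    by (intro has_integral_mult_right) (simp add: o_def x_def)
  moreover have "((\<lambda>s. (x \<bullet> w) / c + f s \<bullet> ((c *\<^sub>R matrix_inv A) *v f s)) has_integral
      x \<bullet> w + integral {a..b} (\<lambda>s. f s \<bullet> ((c *\<^sub>R matrix_inv A) *v f s))) {a..b}"
    using has_integral_add[OF has_integral_const_real[of "(x \<bullet> w) / c" a b]
        integrable_integral[OF q]] \<open>c > 0\<close> \<open>a < b\<close>
    by (simp add: c_def)
  ultimately have "2 * (w \<bullet> x)
      \<le> x \<bullet> w + integral {a..b} (\<lambda>s. f s \<bullet> ((c *\<^sub>R matrix_inv A) *v f s))"
    using pointwise by (rule has_integral_le)
  then show ?thesis
    by (simp add: c_def x_def[symmetric] w_def[symmetric] inner_commute)
qed

theorem lemma4: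
  fixes N :: nat
    and Q :: "nat \<Rightarrow> real ^ 'n ^ 'n"
    and \<tau> :: "nat \<Rightarrow> real"
    and \<omega> :: "nat \<Rightarrow> real \<Rightarrow> real ^ 'n"
  assumes "N \<ge> 1"
    and "\<And>i. i \<in> {1..N} \<Longrightarrow> positive_definite (Q i)"
    and "\<And>i. i \<in> {1..N} \<Longrightarrow> \<tau> i > 0"
    and "\<And>i. i \<in> {1..N} \<Longrightarrow> \<omega> i integrable_on {- \<tau> i..0}"
    and "\<And>i. i \<in> {1..N} \<Longrightarrow>
           (\<lambda>s. \<omega> i s \<bullet> ((\<tau> i *\<^sub>R matrix_inv (Q i)) *v \<omega> i s)) integrable_on {- \<tau> i..0}"
  shows "(let x = (\<lambda>i. integral {- \<tau> i..0} (\<omega> i)); Qsum = (\<Sum>i=1..N. Q i)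
          in (\<Sum>i=1..N. x i) \<bullet> (matrix_inv Qsum *v (\<Sum>i=1..N. x i))
               \<le> (\<Sum>i=1..N. integral {- \<tau> i..0}
                     (\<lambda>s. \<omega> i s \<bullet> ((\<tau> i *\<^sub>R matrix_inv (Q i)) *v \<omega> i s))))
       \<and> (\<forall>\<xi> :: nat \<Rightarrow> real ^ 'n.
            (\<Sum>i=1..N. \<xi> i) \<bullet> (matrix_inv (\<Sum>i=1..N. Q i) *v (\<Sum>i=1..N. \<xi> i))
              \<le> (\<Sum>i=1..N. \<xi> i \<bullet> (matrix_inv (Q i) *v \<xi> i)))"
proof -
  have sum_le: "(\<Sum>i=1..N. \<xi> i) \<bullet> (matrix_inv (\<Sum>i=1..N. Q i) *v (\<Sum>i=1..N. \<xi> i))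
      \<le> (\<Sum>i=1..N. \<xi> i \<bullet> (matrix_inv (Q i) *v \<xi> i))" for \<xi> :: "nat \<Rightarrow> real ^ 'n"
    using assms(1,2) by (intro sum_inner_matrix_inv_le) auto
  define x where "x i = integral {- \<tau> i..0} (\<omega> i)" for i
  have "x i \<bullet> (matrix_inv (Q i) *v x i)
      \<le> integral {- \<tau> i..0} (\<lambda>s. \<omega> i s \<bullet> ((\<tau> i *\<^sub>R matrix_inv (Q i)) *v \<omega> i s))"
    if "i \<in> {1..N}" for i
    using integral_inner_matrix_inv_le[of "Q i" "- \<tau> i" 0 "\<omega> i"] assms(2-5)[OF that]
    by (simp add: x_def)
  then have "(\<Sum>i=1..N. x i \<bullet> (matrix_inv (Q i) *v x i))
      \<le> (\<Sum>i=1..N. integral {- \<tau> i..0}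
           (\<lambda>s. \<omega> i s \<bullet> ((\<tau> i *\<^sub>R matrix_inv (Q i)) *v \<omega> i s)))"
    by (rule sum_mono)
  with sum_le[of x] show ?thesis
    unfolding Let_def x_def using sum_le by (blast intro: order_trans)
qed

end
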